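(* Let $\alpha,\beta\in\mathbb{R}^+$ satisfy $\alpha\beta=\frac{\pi^2}{4}$, and let $r$ be a positive integer. Suppose that $\omega$ (a variable that does not occur in the formula below) satisfies $\omega\neq-(2m+1)^2\alpha$ and $\omega\neq(2m+1)^2\beta$ for $0\le m<\infty$. Then $$ \begin{aligned} &-2\beta^{-r}\left(\frac12\lambda(2r+1)-\sum_{m=0}^{\infty}\frac{(2m+1)^{-2r-1}}{e^{2(2m+1)\beta}+1}\right)+2(-1)^r\alpha^{-r}\left(\frac12\lambda(2r+1)-\sum_{m=0}^{\infty}\frac{(2m+1)^{-2r-1}}{e^{2(2m+1)\alpha}+1}\right)\\ &=-\frac12\sum_{k=1}^{r}\frac{2^{2r+2}(2^{2k}-1)(2^{2(r+1-k)}-1)\,|B_{2k}|\,B_{2(r+1-k)}}{(2k)!\,(2(r+1-k))!}\,\alpha^k\beta^{r+1-k}\\ &=-2^{2r+1}\sum_{k=1}^{r}\frac{k(r+1-k)\,E_{2k-1}(0)\,E_{2(r+1-k)-1}(0)}{(2k)!\,(2(r+1-k))!}\,\alpha^k\beta^{r+1-k}\\ &=-2^{2r-1}\sum_{k=1}^{r}\frac{G_{2k}\,G_{2(r+1-k)}}{(2k)!\,(2(r+1-k))!}\,\alpha^k\beta^{r+1-k}. \end{aligned} $$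
   Context: The Dirichlet lambda function is $\lambda(z)=\sum_{n=0}^{\infty}\frac{1}{(2n+1)^z}$ for $\operatorname{Re}(z)>1$. $B_n$ are the Bernoulli numbers, $\frac{t}{e^t-1}=\sum_{n\ge0}B_n\frac{t^n}{n!}$. $E_n(0)$ are the values at $0$ of the Euler polynomials, $\frac{2e^{xt}}{e^t+1}=\sum_{n\ge0}E_n(x)\frac{t^n}{n!}$. $G_n$ are the Genocchi numbers, $\frac{2t}{e^t+1}=\sum_{n\ge0}G_n\frac{t^n}{n!}$.
   Formalization: The factor (-1)^{k+1} is inserted in the k-th term of the Euler and Genocchi sums; as printed, the second equality fails for every r ≥ 2 (e.g. r = 2, α = β = π/2: the Bernoulli form is 0, the Euler form is not). *)

theory Defs
  imports "HOL-Analysis.Analysis"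
begin

(* Meaningful where the series converges, i.e. for Re z > 1 (complex instance) or z > 1 (real
   instance). *)
definition dirichlet_lambda :: "'a \<Rightarrow> 'a::{real_normed_field, banach, ln}" where
  "dirichlet_lambda z = (\<Sum>n. 1 / of_nat (2 * n + 1) powr z)"

(* The three families of numbers are read off their exponential generating functions.  In the
   first one the denominator has zero constant term; the division of power series cancels the
   common factor X. *)
definition bernoulli_num :: "nat \<Rightarrow> real" where
  "bernoulli_num n = fact n * fps_nth (fps_X / (fps_exp 1 - 1)) n"

definition euler_poly :: "nat \<Rightarrow> real \<Rightarrow> real" where
  "euler_poly n x = fact n * fps_nth (2 * fps_exp x / (fps_exp 1 + 1)) n"

definition genocchi_num :: "nat \<Rightarrow> real" where
  "genocchi_num n = fact n * fps_nth (2 * fps_X / (fps_exp 1 + 1)) n"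

(* Signs: abs (bernoulli_num (2 * k)) = (-1) ^ (k + 1) * bernoulli_num (2 * k) for k > 0, while
   k * euler_poly (2 * k - 1) 0 = - (2 ^ (2 * k) - 1) * bernoulli_num (2 * k) and
   genocchi_num (2 * k) = - 2 * (2 ^ (2 * k) - 1) * bernoulli_num (2 * k) carry no absolute value.
   Rewriting a sum over abs (bernoulli_num (2 * k)) in terms of Euler or Genocchi numbers
   therefore needs the factor (-1) ^ (k + 1).  The source prints these sums without that
   factor, which is correct only for r = 1; the theorem restores it. *)

end

theory Submission
  imports Defs
begin

text \<open>
  Since \<open>1/2 - 1/(exp (2 x) + 1) = tanh x / 2\<close>, the left-hand side is a combination of two series in
  \<open>tanh\<close>. The partial fraction expansion of \<open>tanh\<close>, which comes from the logarithmic derivative of the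
  reflection formula for \<open>\<Gamma>\<close>, together with \<open>\<pi>\<^sup>2 = 4 \<alpha> \<beta>\<close> turns them into double series over odd
  \<open>a, b\<close>: with \<open>x = a\<^sup>2 \<alpha>\<close> and \<open>y = b\<^sup>2 \<beta>\<close> the general terms are \<open>1/(x^r (x + y))\<close> and \<open>1/(y^r (x + y))\<close>.
  In \<open>(-1)^r/(x^r (x + y)) - 1/(y^r (x + y))\<close> the factor \<open>x + y\<close> cancels, and what remains is a finite
  sum of products of values of \<open>\<lambda>\<close> at even integers. These are Genocchi numbers up to elementary
  factors: expand the partial fractions of \<open>t tanh (t/2) = t - 2 t/(exp t + 1)\<close> into a power series.
\<close>

section \<open>Reflection for \<open>Digamma\<close> and the partial fractions of
  \<open>tanh\<close>\<close>

text \<open>Both sides of \<open>rGamma z * rGamma (1 - z) = sin (pi * z) / pi\<close> are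
  differentiated. The derivative on the left is the product itself times the difference of
  \<open>Digamma\<close> values, and off the integers the product does not vanish, so it can be
  divided out.\<close>

lemma Digamma_reflection_complex:
  fixes z :: complex
  assumes "z \<notin> \<int>"
  shows "Digamma (1 - z) - Digamma z = of_real pi * cot (of_real pi * z)"
proof -
  have z: "z \<notin> \<int>\<^sub>\<le>\<^sub>0" and z': "1 - z \<notin> \<int>\<^sub>\<le>\<^sub>0"
    using assms nonpos_Ints_Int[of z] nonpos_Ints_Int[of "1 - z"] Ints_diff[of 1 "1 - z"] by auto
  have *: "(\<lambda>z :: complex. rGamma z * rGamma (1 - z)) = (\<lambda>z. sin (of_real pi * z) / of_real pi)"
    by (rule ext) (rule rGamma_reflection_complex)
  have "((\<lambda>z. rGamma z * rGamma (1 - z)) has_field_derivative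
          rGamma z * rGamma (1 - z) * (Digamma (1 - z) - Digamma z)) (at z)"
    using z z' by (auto intro!: derivative_eq_intros simp: algebra_simps)
  moreover have "((\<lambda>z. sin (of_real pi * z) / of_real pi) has_field_derivative
          cos (of_real pi * z)) (at z)"
    by (auto intro!: derivative_eq_intros)
  ultimately have "sin (of_real pi * z) / of_real pi * (Digamma (1 - z) - Digamma z)
      = cos (of_real pi * z)"
    unfolding * rGamma_reflection_complex by (rule DERIV_unique)
  moreover have "sin (of_real pi * z) \<noteq> 0"
  proof -
    have "rGamma z * rGamma (1 - z) \<noteq> 0" using z z' by (simp add: rGamma_eq_zero_iff)
    thus ?thesis unfolding rGamma_reflection_complex by simp
  qed
  ultimately show ?thesis by (simp add: cot_def field_simps)
qed

text \<open>On the line Re z = 1/2 the point \<open>1 - z\<close> is the conjugate of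
  \<open>z\<close>, so reflection is a statement about imaginary parts. At z = 1/2 + i x/pi the
  cotangent is -tan(i x) = -i tanh x, and the imaginary parts of the terms of the
  \<open>Digamma\<close> series are the partial fractions.\<close>

lemma tanh_sums:
  fixes x :: real
  shows "(\<lambda>n. 8 * x / (real (2 * n + 1) ^ 2 * pi ^ 2 + 4 * x ^ 2)) sums tanh x"
proof -
  define y where "y = x / pi"
  define z where "z = Complex (1 / 2) y"
  have z1: "1 - z = Complex (1 / 2) (- y)"
    by (simp add: z_def complex_eq_iff)
  have nz: "z \<notin> \<int>"
  proof
    assume "z \<in> \<int>"
    then obtain k where "z = of_int k" by (auto elim: Ints_cases)
    hence "1 / 2 = (of_int k :: real)" by (simp add: z_def complex_eq_iff)
    hence "2 * k = 1" by linarith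
    thus False by presburger
  qed
  \<comment> \<open>The constant and the terms 1/(n+1) cancel when the series at \<open>z\<close> is
    subtracted from the one at \<open>1 - z\<close>.\<close>
  have dg: "(\<lambda>n. inverse (of_nat (Suc n)) - inverse (w + of_nat n)) sums
          (Digamma w + euler_mascheroni)" if "w \<noteq> 0" for w :: complex
    using summable_sums[OF summable_Digamma[OF that]] by (simp add: Digamma_def)
  have "z \<noteq> 0" "1 - z \<noteq> 0"
    using nz by auto
  hence "(\<lambda>n. inverse (z + of_nat n) - inverse (1 - z + of_nat n)) sums
          (Digamma (1 - z) - Digamma z)"
    using sums_diff[OF dg[of "1 - z"] dg[of z]] by simp
  hence "(\<lambda>n. Im (inverse (1 - z + of_nat n) - inverse (z + of_nat n))) sums
          - Im (Digamma (1 - z) - Digamma z)"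
    by (drule_tac sums_minus[OF sums_Im]) simp
  moreover have "Im (inverse (1 - z + of_nat n) - inverse (z + of_nat n)) =
      8 * x / (real (2 * n + 1) ^ 2 * pi ^ 2 + 4 * x ^ 2) * pi" for n
  proof -
    define d where "d = (1 / 2 + real n) ^ 2 + y ^ 2"
    have "d > 0" unfolding d_def by (intro add_pos_nonneg) auto
    have "Im (inverse (1 - z + of_nat n) - inverse (z + of_nat n)) = 2 * y / d"
      unfolding z1 unfolding z_def by (simp add: d_def add_divide_distrib[symmetric])
    also have "d = (real (2 * n + 1) ^ 2 * pi ^ 2 + 4 * x ^ 2) / (4 * pi ^ 2)"
      by (simp add: d_def y_def field_simps power2_eq_square)
    also have "2 * y / \<dots> = 8 * x / (real (2 * n + 1) ^ 2 * pi ^ 2 + 4 * x ^ 2) * pi"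
      by (simp add: y_def power2_eq_square)
    finally show ?thesis .
  qed
  moreover have "- Im (Digamma (1 - z) - Digamma z) = tanh x * pi"
  proof -
    have "of_real pi * z = of_real (pi / 2) + \<i> * of_real x"
      by (simp add: z_def complex_eq_iff y_def)
    moreover have half_pi: "cos (complex_of_real (pi / 2)) = 0" "sin (complex_of_real (pi / 2)) = 1"
      by (simp_all only: cos_of_real sin_of_real cos_pi_half sin_pi_half of_real_0 of_real_1)
    ultimately have "cot (of_real pi * z) = - tan (\<i> * of_real x)"
      by (simp add: cot_def tan_def sin_add cos_add half_pi del: of_real_divide)
    also have "tan (\<i> * of_real x) = \<i> * of_real (tanh x)"
      
      using tanh_conv_tan[of "of_real x"] by (simp add: tanh_def sinh_field_def cosh_field_def exp_of_real flip: of_real_minus)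
    finally have "cot (of_real pi * z) = - (\<i> * of_real (tanh x))" .
    thus ?thesis
      unfolding Digamma_reflection_complex[OF nz] by simp
  qed
  ultimately have "(\<lambda>n. 8 * x / (real (2 * n + 1) ^ 2 * pi ^ 2 + 4 * x ^ 2) * pi) sums (tanh x * pi)"
    by simp
  thus ?thesis
    by (subst (asm) sums_mult2_iff) auto
qed

section \<open>Genocchi numbers against Bernoulli numbers and Euler polynomials\<close>

text \<open>Replaces the quotient in the definition by an equation between products, which is how
  the Genocchi numbers are identified from here on. The factor \<open>fps_exp 1 + 1\<close> has
  constant term 2, so it can be cancelled.\<close>

lemma genocchi_num_unique:
  assumes "F * (fps_exp 1 + 1) = 2 * fps_X"
  shows "genocchi_num n = fact n * fps_nth F n"
proof -
  have "fps_nth (fps_exp 1 + 1 :: real fps) 0 \<noteq> fps_nth 0 0"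
    by simp
  hence "fps_exp 1 + 1 \<noteq> (0 :: real fps)"
    by metis
  hence "2 * fps_X / (fps_exp 1 + 1) = F"
    unfolding assms[symmetric] by (rule nonzero_mult_div_cancel_right)
  thus ?thesis by (simp add: genocchi_num_def)
qed

text \<open>With B(t) = t/(e^t - 1), factoring e^(2t) - 1 gives 2t/(e^t + 1) = 2 B(t) - 2 B(2t). The
  series \<open>B2\<close> is B(2t), whose coefficients carry the extra factor
  \<open>2 ^ n\<close>.\<close>

lemma genocchi_num_eq_bernoulli_num:
  "genocchi_num n = - 2 * (2 ^ n - 1) * bernoulli_num n"
proof -
  define e where "e = (fps_exp 1 :: real fps)"
  define B where "B = fps_X / (e - 1)"
  define B2 where "B2 = fps_compose B (fps_const 2 * fps_X)"
  have nz: "e - 1 \<noteq> 0" by (simp add: e_def)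
  \<comment> \<open>Needed for the division in \<open>B\<close> to be exact: \<open>e - 1\<close>
    has no constant term and is not a unit.\<close>
  have "subdegree (e - 1) \<le> 1"
    by (rule subdegree_leI) (simp add: e_def)
  hence "(e - 1) dvd fps_X"
    using nz by (subst fps_dvd_iff) auto
  hence B: "B * (e - 1) = fps_X" by (simp add: B_def)
  have "fps_compose (B * (e - 1)) (fps_const 2 * fps_X) = 2 * fps_X"
    unfolding B by (simp add: numeral_fps_const)
  hence "B2 * (fps_compose e (fps_const 2 * fps_X) - 1) = 2 * fps_X"
    by (simp add: fps_compose_mult_distrib B2_def fps_compose_sub_distrib)
  also have "fps_compose e (fps_const 2 * fps_X) = e * e"
    by (simp add: e_def flip: fps_exp_add_mult)
  finally have B2: "B2 * (e * e - 1) = 2 * fps_X" .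
  have "(2 * B - 2 * B2) * (e + 1) * (e - 1) = 2 * (B * (e - 1)) * (e + 1) - 2 * (B2 * (e * e - 1))"
    by (simp add: algebra_simps)
  also have "\<dots> = 2 * fps_X * (e - 1)"
    unfolding B B2 by (simp add: algebra_simps)
  finally have "(2 * B - 2 * B2) * (e + 1) = 2 * fps_X"
    using nz by simp
  from genocchi_num_unique[OF this[unfolded e_def]]
  have "genocchi_num n = fact n * (2 * fps_nth B n - 2 * fps_nth B2 n)"
    by (simp add: numeral_fps_const)
  also have "fps_nth B2 n = 2 ^ n * fps_nth B n"
    unfolding B2_def by (simp add: fps_compose_linear)
  finally show ?thesis
    by (simp add: bernoulli_num_def B_def e_def algebra_simps)
qed

text \<open>The Genocchi generating function is X times that of the Euler values at 0; the factor
  \<open>Suc n\<close> is the quotient of the two factorials.\<close>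

lemma genocchi_num_eq_euler_poly:
  "genocchi_num (Suc n) = real (Suc n) * euler_poly n 0"
proof -
  define E where "E = 2 / (fps_exp 1 + 1 :: real fps)"
  have "is_unit (fps_exp 1 + 1 :: real fps)"
    by (simp only: fps_is_unit_iff) simp
  hence "E * (fps_exp 1 + 1) = 2"
    unfolding E_def using dvd_div_mult_self unit_imp_dvd by blast
  hence "(fps_X * E) * (fps_exp 1 + 1) = 2 * fps_X"
    by (simp add: mult.assoc mult.commute[of fps_X])
  from genocchi_num_unique[OF this, of "Suc n"] show ?thesis
    by (simp add: euler_poly_def E_def)
qed

section \<open>Uniqueness of power series and sums over products\<close>

text \<open>If the difference \<open>H\<close> were nonzero, dividing it by X to the power
  \<open>n = subdegree H\<close> would give a function continuous at 0 whose value there is the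
  leading coefficient, although it vanishes on a punctured neighbourhood of 0.\<close>

lemma has_fps_expansion_unique:
  fixes F G :: "'a :: {banach, real_normed_field} fps"
  assumes "f has_fps_expansion F" "f has_fps_expansion G"
  shows "F = G"
proof (rule ccontr)
  assume "F \<noteq> G"
  define H n where "H = F - G" and "n = subdegree H"
  have "(\<lambda>z. f z - f z) has_fps_expansion H"
    unfolding H_def by (intro has_fps_expansion_diff assms)
  hence H: "fps_conv_radius H > 0" "\<forall>\<^sub>F z in nhds 0. eval_fps H z = 0"
    by (simp_all add: has_fps_expansion_def)
  have "isCont (eval_fps (fps_shift n H)) 0"
    using H(1) by (intro continuous_eval_fps) (auto simp: zero_ereal_def)
  hence lim: "eval_fps (fps_shift n H) \<midarrow>0\<rightarrow> fps_nth H n"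
    by (simp add: isCont_def eval_fps_at_0)
  have "\<forall>\<^sub>F z in at 0. eval_fps (fps_shift n H) z = 0"
  proof -
    obtain r where r: "r > 0" "ereal r < fps_conv_radius H"
      using H(1) ereal_dense2[of 0 "fps_conv_radius H"] by (auto simp: zero_ereal_def)
    have "\<forall>\<^sub>F z in at (0::'a). z \<in> ball 0 r - {0}"
      using r(1) by (intro eventually_at_in_open) auto
    moreover have "\<forall>\<^sub>F z in at 0. eval_fps H z = 0"
      using H(2) unfolding eventually_nhds eventually_at_topological by blast
    ultimately show ?thesis
    proof eventually_elim
      case (elim z)
      have "ereal (norm z) < fps_conv_radius H"
        using elim(1) r(2) by (auto intro: less_trans[of "ereal (norm z)" "ereal r"])
      thus ?case
        using elim by (subst eval_fps_shift) (auto simp: n_def)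
    qed
  qed
  hence "eval_fps (fps_shift n H) \<midarrow>0\<rightarrow> 0"
    by (rule tendsto_eventually)
  with lim have "fps_nth H n = 0"
    by (rule LIM_unique)
  moreover have "H \<noteq> 0"
    using \<open>F \<noteq> G\<close> by (simp add: H_def)
  ultimately show False
    by (simp add: n_def)
qed

text \<open>Nonnegativity lets convergence of the iterated sum imply summability on the product set.
  This provides the majorants for the double series and evaluates the products of lambda
  values.\<close>

lemma has_sum_mult_nonneg:
  fixes f :: "'a \<Rightarrow> real" and g :: "'b \<Rightarrow> real"
  assumes f: "(f has_sum a) A" "\<And>x. x \<in> A \<Longrightarrow> f x \<ge> 0"
    and g: "(g has_sum b) B" "\<And>y. y \<in> B \<Longrightarrow> g y \<ge> 0"
  shows "((\<lambda>(x, y). f x * g y) has_sum (a * b)) (A \<times> B)"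
proof (rule has_sum_SigmaI)
  show row: "((\<lambda>y. case (x, y) of (x, y) \<Rightarrow> f x * g y) has_sum f x * b) B" for x
    using has_sum_cmult_right[OF g(1)] by simp
  show col: "((\<lambda>x. f x * b) has_sum a * b) A"
    by (rule has_sum_cmult_left[OF f(1)])
  show "(\<lambda>(x, y). f x * g y) summable_on A \<times> B"
    by (rule summable_on_SigmaI[OF row]) (use col f g in \<open>auto simp: summable_on_def\<close>)
qed

lemma has_sum_sum:
  fixes f :: "'i \<Rightarrow> 'a \<Rightarrow> 'b :: topological_comm_monoid_add"
  assumes "\<And>i. i \<in> I \<Longrightarrow> (f i has_sum S i) A"
  shows "((\<lambda>x. \<Sum>i\<in>I. f i x) has_sum (\<Sum>i\<in>I. S i)) A"
  using assms by (induction I rule: infinite_finite_induct) (auto intro: has_sum_add)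

section \<open>Values of \<open>dirichlet_lambda\<close> at even integers\<close>

lemma has_sum_dirichlet_lambda:
  assumes "n \<ge> 2"
  shows "((\<lambda>m. 1 / real (2 * m + 1) ^ n) has_sum dirichlet_lambda (real n)) UNIV"
proof -
  have "summable (\<lambda>m. 1 / real (2 * m + 1) ^ n)"
  proof (rule summable_comparison_test')
    show "summable (\<lambda>m. inverse (real (Suc m) ^ n))"
      using inverse_power_summable[OF assms, where ?'a = real]
      by (subst summable_Suc_iff)
    show "norm (1 / real (2 * m + 1) ^ n) \<le> inverse (real (Suc m) ^ n)" for m
      unfolding inverse_eq_divide by (simp, intro divide_left_mono power_mono) auto
  qed
  moreover have "dirichlet_lambda (real n) = (\<Sum>m. 1 / real (2 * m + 1) ^ n)"
    unfolding dirichlet_lambda_def by (simp add: powr_realpow del: of_nat_Suc of_nat_add)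
  ultimately show ?thesis
    by (intro sums_nonneg_imp_has_sum) (auto simp: sums_iff)
qed

lemma tanh_real_eq:
  fixes x :: real
  shows "tanh x = 1 - 2 / (exp (2 * x) + 1)"
proof -
  define e where "e = exp (2 * x)"
  have e: "e > 0" by (simp add: e_def)
  have "tanh x = (1 - inverse e) / (1 + inverse e)"
    by (simp add: tanh_real_altdef e_def exp_minus)
  also have "1 - inverse e = (e - 1) / e"
    using e by (simp add: field_simps)
  also have "1 + inverse e = (e + 1) / e"
    using e by (simp add: field_simps)
  also have "(e - 1) / e / ((e + 1) / e) = 1 - 2 / (e + 1)"
    using e by (simp add: divide_simps)
  finally show ?thesis by (simp add: e_def)
qed

text \<open>Each partial fraction \<open>4 * t ^ 2 / (c n + t ^ 2)\<close> is a geometric series in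
  \<open>- (t ^ 2 / c n)\<close>, and the two summations are exchanged. The bound 1 on |t| is
  smaller than the radius of convergence pi, but a neighbourhood of 0 is enough to read off
  coefficients.\<close>

lemma has_sum_tanh_expansion:
  fixes t :: real
  assumes "\<bar>t\<bar> < 1"
  shows "((\<lambda>k. 4 * (-1) ^ k * dirichlet_lambda (real (2 * k + 2)) / pi ^ (2 * k + 2) * t ^ (2 * k + 2))
           has_sum t * tanh (t / 2)) UNIV"
proof -
  define c where "c = (\<lambda>n. real (2 * n + 1) ^ 2 * pi ^ 2)"
  define f where "f = (\<lambda>(n, k). 4 * (-1) ^ k * (t ^ 2 / c n) ^ (k + 1))"
  have t2: "t ^ 2 < 1"
    using assms by (simp add: abs_square_less_1)
  have pi1: "pi ^ 2 \<ge> 1"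
    using pi_ge_two by (intro one_le_power) auto
  have c_ge: "c n \<ge> real (2 * n + 1) ^ 2" for n
    using mult_left_mono[OF pi1, of "real (2 * n + 1) ^ 2"] by (simp add: c_def)
  have c1: "c n \<ge> 1" for n
    using c_ge[of n] one_le_power[of "real (2 * n + 1)" 2] by linarith
  have f: "f summable_on UNIV \<times> UNIV"
  proof (rule abs_summable_summable, rule Infinite_Sum.abs_summable_on_comparison_test')
    \<comment> \<open>Since \<open>c n ^ (k + 1)\<close> is at least
      \<open>real (2 * n + 1) ^ 2\<close>, the double series is dominated by the product of the
      series for lambda(2) and a geometric series.\<close>
    have "((\<lambda>k. 4 * ((t ^ 2) * (t ^ 2) ^ k)) has_sum 4 * ((t ^ 2) * (1 / (1 - t ^ 2)))) UNIV"
      using t2 by (intro has_sum_cmult_right sums_nonneg_imp_has_sum geometric_sums) auto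
    from has_sum_mult_nonneg[OF has_sum_dirichlet_lambda[of 2] _ this]
    show "(\<lambda>(n, k). 1 / real (2 * n + 1) ^ 2 * (4 * ((t ^ 2) * (t ^ 2) ^ k))) summable_on UNIV \<times> UNIV"
      by (auto simp: summable_on_def)
    fix p :: "nat \<times> nat"
    obtain n k where p: "p = (n, k)" by force
    have "real (2 * n + 1) ^ 2 \<le> c n ^ 1" using c_ge by simp
    also have "\<dots> \<le> c n ^ (k + 1)" by (intro power_increasing c1) auto
    finally have "(t ^ 2) ^ (k + 1) / c n ^ (k + 1) \<le> (t ^ 2) ^ (k + 1) / real (2 * n + 1) ^ 2"
      using c1[of n] by (intro divide_left_mono mult_pos_pos zero_less_power) auto
    moreover have "norm (f p) = 4 * ((t ^ 2) ^ (k + 1) / c n ^ (k + 1))"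
      using c1[of n] by (simp add: f_def p abs_mult power_abs power_divide)
    ultimately show "norm (f p) \<le> (case p of (n, k) \<Rightarrow> 1 / real (2 * n + 1) ^ 2 * (4 * ((t ^ 2) * (t ^ 2) ^ k)))"
      by (simp add: p)
  qed
  then obtain S where S: "(f has_sum S) (UNIV \<times> UNIV)"
    by (auto simp: summable_on_def)
  \<comment> \<open>Summing over \<open>k\<close> first recovers the partial fractions and
    identifies the total \<open>S\<close>.\<close>
  have "((\<lambda>n. 4 * t ^ 2 / (c n + t ^ 2)) has_sum S) UNIV"
  proof (rule has_sum_SigmaD[OF S])
    fix n
    have *: "norm (- (t ^ 2 / c n)) < 1"
      using t2 c1[of n] by simp
    have "((\<lambda>k. 4 * (t ^ 2 / c n) * (- (t ^ 2 / c n)) ^ k) has_sum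
            4 * (t ^ 2 / c n) * (1 / (1 - - (t ^ 2 / c n)))) UNIV"
      using * by (intro has_sum_cmult_right norm_summable_imp_has_sum geometric_sums)
         (auto simp: power_abs intro!: summable_geometric)
    also have "1 - - (t ^ 2 / c n) = (c n + t ^ 2) / c n"
      using c1[of n] by (simp add: field_simps)
    also have "4 * (t ^ 2 / c n) * (1 / ((c n + t ^ 2) / c n)) = 4 * t ^ 2 / (c n + t ^ 2)"
      using c1[of n] by simp
    also have "(\<lambda>k. 4 * (t ^ 2 / c n) * (- (t ^ 2 / c n)) ^ k) = (\<lambda>k. f (n, k))"
      by (simp add: f_def fun_eq_iff power_minus[of "t ^ 2 / c n"] mult_ac)
    finally show "((\<lambda>k. f (n, k)) has_sum 4 * t ^ 2 / (c n + t ^ 2)) UNIV" .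
  qed
  hence "(\<lambda>n. 4 * t ^ 2 / (c n + t ^ 2)) sums S"
    by (rule has_sum_imp_sums)
  moreover have "(\<lambda>n. 4 * t ^ 2 / (c n + t ^ 2)) sums (t * tanh (t / 2))"
    using sums_mult[OF tanh_sums[of "t / 2"], of t]
    by (simp add: c_def power2_eq_square mult_ac)
  ultimately have "S = t * tanh (t / 2)"
    by (rule sums_unique2)
  \<comment> \<open>Summing the same family over \<open>n\<close> first produces the lambda
    values.\<close>
  moreover have "((\<lambda>k. 4 * (-1) ^ k * dirichlet_lambda (real (2 * k + 2)) / pi ^ (2 * k + 2) * t ^ (2 * k + 2)) has_sum S) UNIV"
  proof (rule has_sum_SigmaD)
    show "((\<lambda>(k, n). f (n, k)) has_sum S) (UNIV \<times> UNIV)"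
      using S by (subst (asm) has_sum_swap)
    fix k
    have "((\<lambda>n. 4 * (-1) ^ k / pi ^ (2 * k + 2) * t ^ (2 * k + 2) * (1 / real (2 * n + 1) ^ (2 * k + 2)))
            has_sum (4 * (-1) ^ k / pi ^ (2 * k + 2) * t ^ (2 * k + 2) * dirichlet_lambda (real (2 * k + 2)))) UNIV"
      by (intro has_sum_cmult_right has_sum_dirichlet_lambda) auto
    moreover have "4 * (-1) ^ k / pi ^ (2 * k + 2) * t ^ (2 * k + 2) * (1 / real (2 * n + 1) ^ (2 * k + 2)) = f (n, k)" for n
    proof -
      have "x ^ (2 * k + 2) = (x ^ 2) ^ (k + 1)" for x :: real
        unfolding power_mult[symmetric] by simp
      thus ?thesis
        by (simp only: f_def c_def prod.case power_divide power_mult_distrib) simp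
    qed
    ultimately show "((\<lambda>n. case (k, n) of (k, n) \<Rightarrow> f (n, k)) has_sum
        4 * (-1) ^ k * dirichlet_lambda (real (2 * k + 2)) / pi ^ (2 * k + 2) * t ^ (2 * k + 2)) UNIV"
      by (simp add: mult_ac del: power_Suc of_nat_add)
  qed
  ultimately show ?thesis by simp
qed

text \<open>The function t - t tanh(t/2) equals 2t/(e^t + 1), so \<open>fps_X - H\<close> is the
  Genocchi series when \<open>H\<close> is the series of t tanh(t/2). The term X affects index 1
  only; at even indices the coefficient of \<open>H\<close> just changes sign, which turns
  \<open>(-1) ^ (k - 1)\<close> into \<open>(-1) ^ k\<close>.\<close>

lemma genocchi_num_even:
  assumes "k \<ge> 1"
  shows "genocchi_num (2 * k) = 4 * (-1) ^ k * fact (2 * k) * dirichlet_lambda (real (2 * k)) / pi ^ (2 * k)"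
proof -
  define H where "H = Abs_fps (\<lambda>n. if even n \<and> n > 0
      then 4 * (-1) ^ (n div 2 - 1) * dirichlet_lambda (real n) / pi ^ n else 0)"
  have H_sums: "(\<lambda>n. fps_nth H n * t ^ n) sums (t * tanh (t / 2))" if "\<bar>t\<bar> < 1" for t
  proof -
    \<comment> \<open>Enumerates the positive even exponents; all other coefficients of
      \<open>H\<close> vanish, so the expansion in even powers is a full power series.\<close>
    define h where "h = (\<lambda>k :: nat. 2 * k + 2)"
    have h: "inj h" by (auto simp: h_def inj_def)
    have "((\<lambda>n. fps_nth H n * t ^ n) has_sum (t * tanh (t / 2))) (range h)"
      unfolding has_sum_reindex[OF h] using has_sum_tanh_expansion[OF that]
      by (simp add: o_def h_def H_def)
    moreover have "fps_nth H n = 0" if "n \<notin> range h" for n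
    proof (rule ccontr)
      assume "fps_nth H n \<noteq> 0"
      hence "even n" "n > 0" by (auto simp: H_def split: if_splits)
      hence "n = h (n div 2 - 1)" by (auto simp: h_def elim!: evenE)
      thus False using that by blast
    qed
    ultimately have "((\<lambda>n. fps_nth H n * t ^ n) has_sum (t * tanh (t / 2))) UNIV"
      by (subst has_sum_cong_neutral[where T = "range h" and g = "\<lambda>n. fps_nth H n * t ^ n"]) auto
    thus ?thesis by (rule has_sum_imp_sums)
  qed
  have radius: "fps_conv_radius H > 0"
  proof -
    have "fps_conv_radius H \<ge> norm (1 / 2 :: real)"
      unfolding fps_conv_radius_def using H_sums[of "1 / 2"]
      by (intro conv_radius_geI) (auto simp: sums_iff)
    thus ?thesis by (rule less_le_trans[rotated]) auto
  qed
  have "\<forall>\<^sub>F t in nhds 0. t \<in> ball (0 :: real) 1"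
    by (intro eventually_nhds_in_open) auto
  hence "\<forall>\<^sub>F t in nhds 0. eval_fps H t = t * tanh (t / 2)"
    by eventually_elim (use H_sums in \<open>auto simp: eval_fps_def sums_iff\<close>)
  with radius have "(\<lambda>t. t * tanh (t / 2)) has_fps_expansion H"
    by (simp add: has_fps_expansion_def)
  hence "(\<lambda>t. (t - t * tanh (t / 2)) * (exp t + 1)) has_fps_expansion (fps_X - H) * (fps_exp 1 + 1)"
    by (intro fps_expansion_intros)
  also have "(\<lambda>t :: real. (t - t * tanh (t / 2)) * (exp t + 1)) = (\<lambda>t. 2 * t)"
  proof
    fix t :: real
    have "1 - tanh (t / 2) = 2 / (exp t + 1)"
      by (simp add: tanh_real_eq)
    moreover have "exp t + 1 \<noteq> 0"
      using exp_gt_zero[of t] by linarith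
    ultimately have "(1 - tanh (t / 2)) * (exp t + 1) = 2"
      using nonzero_eq_divide_eq by blast
    hence "t * ((1 - tanh (t / 2)) * (exp t + 1)) = t * 2"
      by simp
    thus "(t - t * tanh (t / 2)) * (exp t + 1) = 2 * t"
      by (simp add: algebra_simps)
  qed
  finally have "(fps_X - H) * (fps_exp 1 + 1) = 2 * fps_X"
    by (rule has_fps_expansion_unique) (intro fps_expansion_intros)
  from genocchi_num_unique[OF this, of "2 * k"] show ?thesis
    using assms by (cases k) (auto simp: H_def)
qed

section \<open>The \<open>tanh\<close> series as double series over odd numbers\<close>

lemma tanh_lambda_suminf:
  fixes \<beta> :: real
  assumes "\<beta> > 0" "r \<ge> 1"
  shows "1 / 2 * dirichlet_lambda (2 * real r + 1)
           - (\<Sum>m. real (2 * m + 1) powi (- 2 * int r - 1) / (exp (2 * real (2 * m + 1) * \<beta>) + 1))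
         = 1 / 2 * (\<Sum>m. tanh (real (2 * m + 1) * \<beta>) / real (2 * m + 1) ^ (2 * r + 1))"
proof -
  define a where "a = (\<lambda>m. 1 / real (2 * m + 1) ^ (2 * r + 1))"
  define b where "b = (\<lambda>m. a m / (exp (2 * real (2 * m + 1) * \<beta>) + 1))"
  define g where "g = (\<lambda>m. tanh (real (2 * m + 1) * \<beta>) / real (2 * m + 1) ^ (2 * r + 1))"
  have a0: "a m \<ge> 0" for m
    by (simp add: a_def)
  have a: "a sums dirichlet_lambda (2 * real r + 1)"
    using has_sum_imp_sums[OF has_sum_dirichlet_lambda[of "2 * r + 1"]] assms(2)
    by (simp add: a_def add_ac)
  have b: "summable b"
  proof (rule summable_comparison_test')
    show "summable a" using a by (simp add: sums_iff)
    show "norm (b m) \<le> a m" for m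
      using a0[of m] exp_ge_zero[of "2 * real (2 * m + 1) * \<beta>"]
      by (simp add: b_def abs_mult divide_le_eq mult_le_cancel_left1 del: exp_ge_zero)
  qed
  have "real (2 * m + 1) powi (- 2 * int r - 1) = a m" for m
  proof -
    have "- 2 * int r - 1 = - int (2 * r + 1)" by simp
    thus ?thesis by (simp only: a_def power_int_minus power_int_of_nat inverse_eq_divide)
  qed
  hence "(\<Sum>m. real (2 * m + 1) powi (- 2 * int r - 1) / (exp (2 * real (2 * m + 1) * \<beta>) + 1)) = suminf b"
    by (simp only: b_def)
  moreover have "(\<lambda>m. 1 / 2 * a m - b m) sums (1 / 2 * dirichlet_lambda (2 * real r + 1) - suminf b)"
    by (intro sums_diff sums_mult a summable_sums b)
  moreover have "1 / 2 * a m - b m = 1 / 2 * g m" for m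
  proof -
    have "g m = tanh (real (2 * m + 1) * \<beta>) * a m"
      by (simp add: a_def g_def)
    thus ?thesis
      by (simp only: tanh_real_eq b_def mult.assoc) (simp add: algebra_simps)
  qed
  ultimately have *: "(\<lambda>m. 1 / 2 * g m) sums
      (1 / 2 * dirichlet_lambda (2 * real r + 1)
         - (\<Sum>m. real (2 * m + 1) powi (- 2 * int r - 1) / (exp (2 * real (2 * m + 1) * \<beta>) + 1)))"
    by (simp only:)
  from summable_mult[OF sums_summable[OF this], of 2] have "summable g"
    by simp
  from sums_unique2[OF * sums_mult[OF summable_sums[OF this]]] show ?thesis
    by (simp only: g_def)
qed

lemma has_sum_dirichlet_lambda_scaled:
  assumes "k \<ge> 1"
  shows "((\<lambda>m. 1 / (real (2 * m + 1) ^ 2 * \<alpha>) ^ k) has_sum dirichlet_lambda (real (2 * k)) / \<alpha> ^ k) UNIV"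
  using has_sum_divide_const[OF has_sum_dirichlet_lambda[of "2 * k"], of "\<alpha> ^ k"] assms
  by (simp only: power_mult_distrib divide_divide_eq_left flip: power_mult)

text \<open>Substituting pi^2 = 4 \<alpha> \<beta> into the partial fractions of tanh(a \<alpha>),
  with a and b odd, makes the general term 2a/(a^2 \<alpha> + b^2 \<beta>). Hence the inner sum over
  \<open>n\<close> is a value of \<open>tanh\<close>. The hypotheses are symmetric in \<alpha> and
  \<beta>, so the other series is covered too.\<close>

lemma has_sum_tanh_double:
  fixes \<alpha> \<beta> :: real
  assumes "\<alpha> > 0" "\<beta> > 0" "\<alpha> * \<beta> = pi ^ 2 / 4" "r \<ge> 1"
  shows "((\<lambda>(m, n). 1 / ((real (2 * m + 1) ^ 2 * \<alpha>) ^ r *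
            (real (2 * m + 1) ^ 2 * \<alpha> + real (2 * n + 1) ^ 2 * \<beta>))) has_sum
          (1 / (2 * \<alpha> ^ r) * (\<Sum>m. tanh (real (2 * m + 1) * \<alpha>) / real (2 * m + 1) ^ (2 * r + 1)))) (UNIV \<times> UNIV)"
proof -
  define x y where "x = (\<lambda>m. real (2 * m + 1) ^ 2 * \<alpha>)" and "y = (\<lambda>n. real (2 * n + 1) ^ 2 * \<beta>)"
  define f where "f = (\<lambda>(m, n). 1 / (x m ^ r * (x m + y n)))"
  have x: "x m > 0" and y: "y m > 0" for m
    using assms by (auto simp: x_def y_def)
  have "f summable_on UNIV \<times> UNIV"
  proof (rule summable_on_comparison_test)
    \<comment> \<open>Dropping \<open>x m\<close> from the factor \<open>x m + y n\<close> leaves a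
      product of two convergent series; the exponent 1 gives the second factor the shape of a scaled
      lambda series.\<close>
    show "(\<lambda>(m, n). 1 / x m ^ r * (1 / y n ^ 1)) summable_on UNIV \<times> UNIV"
      using has_sum_mult_nonneg[OF has_sum_dirichlet_lambda_scaled[OF assms(4), of \<alpha>] _
              has_sum_dirichlet_lambda_scaled[of 1 \<beta>]] assms
      unfolding x_def y_def summable_on_def by fastforce
    fix p :: "nat \<times> nat"
    obtain m n where p: "p = (m, n)" by force
    show "0 \<le> f p"
      using x[of m] y[of n] by (simp add: f_def p)
    have "1 / (x m ^ r * (x m + y n)) \<le> 1 / (x m ^ r * y n)"
      using x[of m] y[of n] by (intro divide_left_mono mult_left_mono mult_pos_pos add_pos_pos) auto
    thus "f p \<le> (case p of (m, n) \<Rightarrow> 1 / x m ^ r * (1 / y n ^ 1))"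
      by (simp add: p f_def)
  qed
  then obtain S where S: "(f has_sum S) (UNIV \<times> UNIV)"
    by (auto simp: summable_on_def)
  have "((\<lambda>m. 1 / (2 * \<alpha> ^ r) * (tanh (real (2 * m + 1) * \<alpha>) / real (2 * m + 1) ^ (2 * r + 1))) has_sum S) UNIV"
  proof (rule has_sum_SigmaD[OF S])
    fix m
    define a where "a = real (2 * m + 1)"
    have a: "a > 0" by (simp add: a_def)
    have pi: "pi ^ 2 = 4 * (\<alpha> * \<beta>)"
      using assms by simp
    have "8 * (a * \<alpha>) / (real (2 * n + 1) ^ 2 * pi ^ 2 + 4 * (a * \<alpha>) ^ 2) = 2 * a / (x m + y n)" for n
    proof -
      have "real (2 * n + 1) ^ 2 * pi ^ 2 + 4 * (a * \<alpha>) ^ 2 = 4 * \<alpha> * (x m + y n)"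
        unfolding pi x_def y_def a_def[symmetric] by (simp add: algebra_simps power2_eq_square)
      moreover have "8 * (a * \<alpha>) / (4 * \<alpha> * s) = 2 * a / s" if "s > 0" for s
        using that assms(1) by (simp add: field_simps)
      from this[OF add_pos_pos[OF x[of m] y[of n]]]
      have "8 * (a * \<alpha>) / (4 * \<alpha> * (x m + y n)) = 2 * a / (x m + y n)" .
      ultimately show ?thesis by (simp only:)
    qed
    hence "(\<lambda>n. 2 * a / (x m + y n)) sums tanh (a * \<alpha>)"
      using tanh_sums[of "a * \<alpha>"] by (simp only:)
    hence "((\<lambda>n. 2 * a / (x m + y n)) has_sum tanh (a * \<alpha>)) UNIV"
    proof (rule sums_nonneg_imp_has_sum)
      show "2 * a / (x m + y n) \<ge> 0" for n
        using x[of m] y[of n] a by simp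
    qed
    from has_sum_divide_const[OF this, of "2 * a * x m ^ r"]
    have "((\<lambda>n. 2 * a / (x m + y n) / (2 * a * x m ^ r)) has_sum tanh (a * \<alpha>) / (2 * a * x m ^ r)) UNIV" .
    moreover have "2 * a / (x m + y n) / (2 * a * x m ^ r) = f (m, n)" for n
      using a by (simp add: f_def)
    moreover have "x m ^ r = a ^ (2 * r) * \<alpha> ^ r"
      by (simp only: x_def a_def power_mult_distrib power_mult)
    hence "2 * a * x m ^ r = 2 * \<alpha> ^ r * a ^ (2 * r + 1)"
      by simp
    ultimately show "((\<lambda>n. f (m, n)) has_sum
        1 / (2 * \<alpha> ^ r) * (tanh (real (2 * m + 1) * \<alpha>) / real (2 * m + 1) ^ (2 * r + 1))) UNIV"
      unfolding a_def[symmetric] by simp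
  qed
  hence "((\<lambda>m. tanh (real (2 * m + 1) * \<alpha>) / real (2 * m + 1) ^ (2 * r + 1)) has_sum S / (1 / (2 * \<alpha> ^ r))) UNIV"
    using assms by (subst (asm) has_sum_cmult_right_iff) auto
  hence "(\<Sum>m. tanh (real (2 * m + 1) * \<alpha>) / real (2 * m + 1) ^ (2 * r + 1)) = S / (1 / (2 * \<alpha> ^ r))"
    by (intro sums_unique[symmetric] has_sum_imp_sums)
  hence "1 / (2 * \<alpha> ^ r) * (\<Sum>m. tanh (real (2 * m + 1) * \<alpha>) / real (2 * m + 1) ^ (2 * r + 1)) = S"
    using assms by simp
  with S show ?thesis
    by (simp only: f_def x_def y_def)
qed

text \<open>With u = 1/x and v = 1/y the left side is -(v^r - (-u)^r)/(x + y). The numerator is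
  divisible by v - (-u) = u + v = u v (x + y), which removes the denominator.\<close>

lemma alternating_partial_fractions:
  fixes x y :: real
  assumes "x > 0" "y > 0"
  shows "(-1) ^ r / (x ^ r * (x + y)) - 1 / (y ^ r * (x + y))
           = - (\<Sum>k = 1..r. (-1) ^ (r - k) * (1 / x ^ (r + 1 - k) * (1 / y ^ k)))"
proof -
  define u v where "u = 1 / x" and "v = 1 / y"
  have uv: "u * v * (x + y) = u + v" "u > 0" "v > 0"
    using assms by (auto simp: u_def v_def field_simps)
  have "(-1) ^ r / (x ^ r * (x + y)) - 1 / (y ^ r * (x + y)) = - ((v ^ r - (- u) ^ r) / (x + y))"
    by (simp add: u_def v_def power_minus[of "1 / x"] power_divide diff_divide_distrib)
  also have "(v ^ r - (- u) ^ r) = (u * v * (\<Sum>i<r. (- u) ^ (r - Suc i) * v ^ i)) * (x + y)"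
    unfolding power_diff_sumr2[of v r "- u"] using uv(1) by (simp add: mult_ac)
  also have "\<dots> / (x + y) = (\<Sum>i<r. u * v * ((- u) ^ (r - Suc i) * v ^ i))"
    using assms by (simp add: sum_distrib_left)
  also have "\<dots> = (\<Sum>i<r. (-1) ^ (r - Suc i) * (u ^ (r - i) * v ^ Suc i))"
  proof (intro sum.cong refl)
    fix i assume "i \<in> {..<r}"
    then obtain j where "r = Suc (i + j)"
      using less_imp_Suc_add by auto
    thus "u * v * ((- u) ^ (r - Suc i) * v ^ i) = (-1) ^ (r - Suc i) * (u ^ (r - i) * v ^ Suc i)"
      by (simp add: power_minus[of u] Suc_diff_le)
  qed
  also have "\<dots> = (\<Sum>k = 1..r. (-1) ^ (r - k) * (u ^ (r + 1 - k) * v ^ k))"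
    by (rule sum.reindex_bij_witness[of _ "\<lambda>k. k - 1" Suc]) auto
  finally show ?thesis
    by (simp add: u_def v_def power_divide)
qed

text \<open>Both \<open>tanh\<close> series become sums over the same pairs (m, n), the second after
  exchanging the coordinates. Their termwise combination is a finite sum of functions of m times
  functions of n, and each such product sums to a product of two lambda values.\<close>

lemma tanh_lambda_identity:
  fixes \<alpha> \<beta> :: real
  assumes "\<alpha> > 0" "\<beta> > 0" "\<alpha> * \<beta> = pi ^ 2 / 4" "r \<ge> 1"
  shows "(-1) ^ r / \<alpha> ^ r * (\<Sum>m. tanh (real (2 * m + 1) * \<alpha>) / real (2 * m + 1) ^ (2 * r + 1))
           - 1 / \<beta> ^ r * (\<Sum>m. tanh (real (2 * m + 1) * \<beta>) / real (2 * m + 1) ^ (2 * r + 1))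
         = - 2 * (\<Sum>k = 1..r. (-1) ^ (r - k) *
               (dirichlet_lambda (real (2 * (r + 1 - k))) / \<alpha> ^ (r + 1 - k) * (dirichlet_lambda (real (2 * k)) / \<beta> ^ k)))"
    (is "(-1) ^ r / \<alpha> ^ r * ?A - 1 / \<beta> ^ r * ?B = - 2 * ?R")
proof -
  define x y where "x = (\<lambda>m. real (2 * m + 1) ^ 2 * \<alpha>)" and "y = (\<lambda>n. real (2 * n + 1) ^ 2 * \<beta>)"
  have x: "x m > 0" and y: "y m > 0" for m
    using assms by (auto simp: x_def y_def)
  have "((\<lambda>(m, n). 1 / (x m ^ r * (x m + y n))) has_sum (1 / (2 * \<alpha> ^ r) * ?A)) (UNIV \<times> UNIV)"
    unfolding x_def y_def by (rule has_sum_tanh_double[OF assms])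
  moreover have "((\<lambda>(m, n). 1 / (y n ^ r * (x m + y n))) has_sum (1 / (2 * \<beta> ^ r) * ?B)) (UNIV \<times> UNIV)"
    using has_sum_tanh_double[of \<beta> \<alpha> r] assms unfolding x_def y_def
    by (subst has_sum_swap) (simp add: add.commute mult.commute case_prod_unfold)
  ultimately have s1: "((\<lambda>p. (-1) ^ r * (case p of (m, n) \<Rightarrow> 1 / (x m ^ r * (x m + y n)))
        + (-1) * (case p of (m, n) \<Rightarrow> 1 / (y n ^ r * (x m + y n)))) has_sum
      ((-1) ^ r * (1 / (2 * \<alpha> ^ r) * ?A) + (-1) * (1 / (2 * \<beta> ^ r) * ?B))) (UNIV \<times> UNIV)"
    by (intro has_sum_add has_sum_cmult_right)
  have s2: "((\<lambda>p. - 1 * (\<Sum>k = 1..r. (-1) ^ (r - k) *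
        (case p of (m, n) \<Rightarrow> 1 / x m ^ (r + 1 - k) * (1 / y n ^ k)))) has_sum (- 1 * ?R)) (UNIV \<times> UNIV)"
  proof (intro has_sum_cmult_right has_sum_sum)
    fix k assume k: "k \<in> {1..r}"
    show "((\<lambda>(m, n). 1 / x m ^ (r + 1 - k) * (1 / y n ^ k)) has_sum
        (dirichlet_lambda (real (2 * (r + 1 - k))) / \<alpha> ^ (r + 1 - k) * (dirichlet_lambda (real (2 * k)) / \<beta> ^ k))) (UNIV \<times> UNIV)"
    proof (rule has_sum_mult_nonneg)
      show "((\<lambda>m. 1 / x m ^ (r + 1 - k)) has_sum dirichlet_lambda (real (2 * (r + 1 - k))) / \<alpha> ^ (r + 1 - k)) UNIV"
        using k unfolding x_def by (intro has_sum_dirichlet_lambda_scaled) auto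
      show "((\<lambda>n. 1 / y n ^ k) has_sum dirichlet_lambda (real (2 * k)) / \<beta> ^ k) UNIV"
        using k unfolding y_def by (intro has_sum_dirichlet_lambda_scaled) auto
    qed (use x y in \<open>auto intro!: less_imp_le\<close>)
  qed
  have eq: "(-1) ^ r * (case p of (m, n) \<Rightarrow> 1 / (x m ^ r * (x m + y n)))
        + (-1) * (case p of (m, n) \<Rightarrow> 1 / (y n ^ r * (x m + y n)))
      = - 1 * (\<Sum>k = 1..r. (-1) ^ (r - k) * (case p of (m, n) \<Rightarrow> 1 / x m ^ (r + 1 - k) * (1 / y n ^ k)))" for p
    using alternating_partial_fractions[OF x[of "fst p"] y[of "snd p"], of r] by (simp add: case_prod_unfold)
  have "(-1) ^ r * (1 / (2 * \<alpha> ^ r) * ?A) + (-1) * (1 / (2 * \<beta> ^ r) * ?B) = - 1 * ?R"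
    using s1 s2 unfolding eq by (rule has_sum_unique)
  hence "2 * ((-1) ^ r * (1 / (2 * \<alpha> ^ r) * ?A) + (-1) * (1 / (2 * \<beta> ^ r) * ?B)) = 2 * (- 1 * ?R)"
    by (simp only:)
  moreover have "2 * ((-1) ^ r * (1 / (2 * \<alpha> ^ r) * ?A) + (-1) * (1 / (2 * \<beta> ^ r) * ?B))
     = (-1) ^ r / \<alpha> ^ r * ?A - 1 / \<beta> ^ r * ?B"
    by (simp add: algebra_simps)
  ultimately show ?thesis by simp
qed

section \<open>Signs of the Bernoulli numbers of even index\<close>

lemma dirichlet_lambda_nonneg:
  assumes "n \<ge> 2"
  shows "dirichlet_lambda (real n) \<ge> 0"
  by (rule has_sum_nonneg[OF has_sum_dirichlet_lambda[OF assms]]) simp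

text \<open>Up to the positive factor \<open>q\<close>, the number is \<open>(-1) ^ (k + 1)\<close>
  times the lambda expression \<open>R\<close>, which is nonnegative.\<close>

lemma abs_bernoulli_num_even:
  assumes "k \<ge> 1"
  shows "\<bar>bernoulli_num (2 * k)\<bar> = (-1) ^ (k + 1) * bernoulli_num (2 * k)"
proof -
  define q :: real where "q = 2 ^ (2 * k) - 1"
  define R where "R = 2 * fact (2 * k) * dirichlet_lambda (real (2 * k)) / pi ^ (2 * k)"
  have q: "q > 0"
    unfolding q_def using assms one_less_power[of "2 :: real" "2 * k"] by (simp del: one_less_power)
  have R: "R \<ge> 0"
    unfolding R_def using dirichlet_lambda_nonneg[of "2 * k"] assms
    by simp
  have *: "- 2 * q * bernoulli_num (2 * k) = 2 * (-1) ^ k * R"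
    using genocchi_num_even[OF assms]
    unfolding genocchi_num_eq_bernoulli_num q_def[symmetric] by (simp add: R_def)
  have "b * q = - s * R" if "- 2 * q * b = 2 * s * R" for b s
  proof -
    have "- (b * q) = s * R"
      using that by (simp add: mult.commute)
    thus ?thesis by linarith
  qed
  from this[OF *] have "bernoulli_num (2 * k) * q = (-1) ^ (k + 1) * R"
    by simp
  hence B: "bernoulli_num (2 * k) = (-1) ^ (k + 1) * R / q"
    by (subst nonzero_eq_divide_eq) (use q in simp_all)
  show ?thesis
    unfolding B using R q by (simp add: abs_mult)
qed

section \<open>Assembling the closed forms\<close>

theorem theorem1p18:
  fixes \<alpha> \<beta> :: real and r :: nat and \<omega> :: complex
  assumes "\<alpha> > 0" and "\<beta> > 0"
    and "\<alpha> * \<beta> = pi ^ 2 / 4"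
    and "r \<ge> 1"
    and "\<And>m::nat. \<omega> \<noteq> - of_real (real (2 * m + 1) ^ 2 * \<alpha>)"
    and "\<And>m::nat. \<omega> \<noteq> of_real (real (2 * m + 1) ^ 2 * \<beta>)"
  shows
    "let
       lhs =
         - 2 * \<beta> powi (- int r) *
             (1 / 2 * dirichlet_lambda (2 * real r + 1)
              - (\<Sum>m. real (2 * m + 1) powi (- 2 * int r - 1) / (exp (2 * real (2 * m + 1) * \<beta>) + 1)))
         + 2 * (- 1) ^ r * \<alpha> powi (- int r) *
             (1 / 2 * dirichlet_lambda (2 * real r + 1)
              - (\<Sum>m. real (2 * m + 1) powi (- 2 * int r - 1) / (exp (2 * real (2 * m + 1) * \<alpha>) + 1)));
       bernoulli_form =
         - (1 / 2) * (\<Sum>k = 1..r.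
             2 ^ (2 * r + 2) * (2 ^ (2 * k) - 1) * (2 ^ (2 * (r + 1 - k)) - 1)
               * \<bar>bernoulli_num (2 * k)\<bar> * bernoulli_num (2 * (r + 1 - k))
               / (fact (2 * k) * fact (2 * (r + 1 - k))) * \<alpha> ^ k * \<beta> ^ (r + 1 - k));
       euler_form =
         - (2 ^ (2 * r + 1)) * (\<Sum>k = 1..r.
             (- 1) ^ (k + 1) * (real k * real (r + 1 - k)
               * euler_poly (2 * k - 1) 0 * euler_poly (2 * (r + 1 - k) - 1) 0)
               / (fact (2 * k) * fact (2 * (r + 1 - k))) * \<alpha> ^ k * \<beta> ^ (r + 1 - k));
       genocchi_form =
         - (2 ^ (2 * r - 1)) * (\<Sum>k = 1..r.
             (- 1) ^ (k + 1) * (genocchi_num (2 * k) * genocchi_num (2 * (r + 1 - k)))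
               / (fact (2 * k) * fact (2 * (r + 1 - k))) * \<alpha> ^ k * \<beta> ^ (r + 1 - k))
     in lhs = bernoulli_form \<and> bernoulli_form = euler_form \<and> euler_form = genocchi_form"
proof -
  define S where "S = (\<lambda>\<gamma>. \<Sum>m. tanh (real (2 * m + 1) * \<gamma>) / real (2 * m + 1) ^ (2 * r + 1))"
  define D where "D = (\<lambda>k. fact (2 * k) * fact (2 * (r + 1 - k)) :: real)"
  define P where "P = (\<lambda>k. \<alpha> ^ k * \<beta> ^ (r + 1 - k))"
  \<comment> \<open>The common summand: every expression in the chain is reduced to
    \<open>- (2 ^ (2 * r - 1))\<close> times the sum of \<open>G\<close>.\<close>
  define G where "G = (\<lambda>k. (-1) ^ (k + 1) * (genocchi_num (2 * k) * genocchi_num (2 * (r + 1 - k))) / D k * P k)"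
  have pi: "pi ^ (2 * k) = 4 ^ k * (\<alpha> ^ k * \<beta> ^ k)" for k
  proof -
    have "pi ^ 2 = 4 * (\<alpha> * \<beta>)" using assms(3) by simp
    thus ?thesis by (simp add: power_mult power_mult_distrib)
  qed
  \<comment> \<open>With pi eliminated, dividing by a power of one parameter leaves the same power
    of the other; this is the source of \<open>\<alpha> ^ k * \<beta> ^ (r + 1 - k)\<close>.\<close>
  have lambda: "dirichlet_lambda (real (2 * k)) = (-1) ^ k * genocchi_num (2 * k) * (4 ^ k * (\<alpha> ^ k * \<beta> ^ k)) / (4 * fact (2 * k))"
    if "k \<ge> 1" for k
    using genocchi_num_even[OF that] assms(1,2) unfolding pi by simp
  have lhs: "- 2 * \<beta> powi (- int r) * (1 / 2 * S \<beta>) + 2 * (- 1) ^ r * \<alpha> powi (- int r) * (1 / 2 * S \<alpha>)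
      = - (2 ^ (2 * r - 1)) * (\<Sum>k = 1..r. G k)"
  proof -
    have "- 2 * \<beta> powi (- int r) * (1 / 2 * S \<beta>) + 2 * (- 1) ^ r * \<alpha> powi (- int r) * (1 / 2 * S \<alpha>)
        = (-1) ^ r / \<alpha> ^ r * S \<alpha> - 1 / \<beta> ^ r * S \<beta>"
      by (simp add: power_int_minus field_simps)
    also have "\<dots> = - 2 * (\<Sum>k = 1..r. (-1) ^ (r - k) *
        (dirichlet_lambda (real (2 * (r + 1 - k))) / \<alpha> ^ (r + 1 - k) * (dirichlet_lambda (real (2 * k)) / \<beta> ^ k)))"
      unfolding S_def by (rule tanh_lambda_identity[OF assms(1-4)])
    also have "\<dots> = - 2 * (\<Sum>k = 1..r. 4 ^ (r - 1) * G k)"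
    proof (intro arg_cong[of _ _ "\<lambda>s. - 2 * s"] sum.cong refl)
      fix k assume k: "k \<in> {1..r}"
      \<comment> \<open>Writing r = k + j and k = i + 1 removes the truncated subtractions:
        \<open>r + 1 - k\<close> is \<open>Suc j\<close> and \<open>r - 1\<close> is
        \<open>i + j\<close>.\<close>
      then obtain j where j: "r = k + j"
        by (auto simp: le_iff_add)
      obtain i where i: "k = Suc i"
        using k by (cases k) auto
      have "(-1) ^ j * (dirichlet_lambda (real (2 * (Suc j))) / \<alpha> ^ (Suc j) * (dirichlet_lambda (real (2 * k)) / \<beta> ^ k))
          = 4 ^ (i + j) * ((-1) ^ (k + 1) * (genocchi_num (2 * k) * genocchi_num (2 * Suc j)) / (fact (2 * k) * fact (2 * Suc j)) * (\<alpha> ^ k * \<beta> ^ Suc j))"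
      proof -
        \<comment> \<open>The sign of the partial fraction and that of lambda(2(j+1)) combine to -1,
          which together with \<open>(-1) ^ k\<close> from lambda(2k) gives
          \<open>(-1) ^ (k + 1)\<close>.\<close>
        have sgn: "(-1) ^ j * (-1) ^ Suc j = (-1 :: real)"
          by (simp flip: power_mult_distrib)
        define X where "X = (4 :: real) ^ j"
        define Y where "Y = (4 :: real) ^ i"
        have "dirichlet_lambda (real (2 * Suc j)) / \<alpha> ^ Suc j = (-1) ^ Suc j * genocchi_num (2 * Suc j) * X * \<beta> ^ Suc j / fact (2 * Suc j)"
          using assms(1) lambda[of "Suc j"] unfolding power_Suc[of 4] X_def[symmetric]
          by (simp del: fact_Suc power_Suc mult_Suc_right)
        moreover have "dirichlet_lambda (real (2 * k)) / \<beta> ^ k = (-1) ^ k * genocchi_num (2 * k) * Y * \<alpha> ^ k / fact (2 * k)"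
          using assms(2) lambda[of "Suc i"] unfolding i power_Suc[of 4] Y_def[symmetric]
          by (simp del: fact_Suc power_Suc mult_Suc_right)
        ultimately have "(-1) ^ j * (dirichlet_lambda (real (2 * (Suc j))) / \<alpha> ^ (Suc j) * (dirichlet_lambda (real (2 * k)) / \<beta> ^ k))
          = ((-1) ^ j * (-1) ^ Suc j) * ((-1) ^ k * genocchi_num (2 * k) * Y * \<alpha> ^ k / fact (2 * k)) * (genocchi_num (2 * Suc j) * X * \<beta> ^ Suc j / fact (2 * Suc j))"
          by (simp only: times_divide_eq_left times_divide_eq_right divide_divide_eq_left mult_ac)
        thus ?thesis
          unfolding sgn power_add by (simp add: X_def Y_def mult_ac del: fact_Suc)
      qed
      thus "(-1) ^ (r - k) *
        (dirichlet_lambda (real (2 * (r + 1 - k))) / \<alpha> ^ (r + 1 - k) * (dirichlet_lambda (real (2 * k)) / \<beta> ^ k)) = 4 ^ (r - 1) * G k"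
        by (simp add: j i G_def D_def P_def del: fact_Suc power_Suc mult_Suc_right)
    qed
    also have "\<dots> = - (2 * 4 ^ (r - 1)) * (\<Sum>k = 1..r. G k)"
      by (simp flip: sum_distrib_left)
    also have "2 * 4 ^ (r - 1) = (2 :: real) ^ (2 * r - 1)"
    proof -
      obtain q where "r = Suc q" using assms(4) by (cases r) auto
      thus ?thesis by (simp add: power_mult)
    qed
    finally show ?thesis .
  qed
  \<comment> \<open>These rely on r being positive, so that \<open>2 * r - 1\<close> is not
    truncated.\<close>
  have r: "(2 :: real) ^ (2 * r + 2) = 8 * 2 ^ (2 * r - 1)" "(2 :: real) ^ (2 * r + 1) = 4 * 2 ^ (2 * r - 1)"
  proof -
    obtain q where "r = Suc q" using assms(4) by (cases r) auto
    thus "(2 :: real) ^ (2 * r + 2) = 8 * 2 ^ (2 * r - 1)" "(2 :: real) ^ (2 * r + 1) = 4 * 2 ^ (2 * r - 1)"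
      by simp_all
  qed
  have bernoulli: "- (1 / 2) * (\<Sum>k = 1..r.
             2 ^ (2 * r + 2) * (2 ^ (2 * k) - 1) * (2 ^ (2 * (r + 1 - k)) - 1)
               * \<bar>bernoulli_num (2 * k)\<bar> * bernoulli_num (2 * (r + 1 - k))
               / (fact (2 * k) * fact (2 * (r + 1 - k))) * \<alpha> ^ k * \<beta> ^ (r + 1 - k))
      = - (2 ^ (2 * r - 1)) * (\<Sum>k = 1..r. G k)"
    unfolding sum_distrib_left
  proof (rule sum.cong)
    fix k assume k: "k \<in> {1..r}"
    define a b where "a = (2 :: real) ^ (2 * k) - 1" and "b = (2 :: real) ^ (2 * (r + 1 - k)) - 1"
    define u v where "u = bernoulli_num (2 * k)" and "v = bernoulli_num (2 * (r + 1 - k))"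
    define d e where "d = (fact (2 * k) :: real)" and "e = (fact (2 * (r + 1 - k)) :: real)"
    \<comment> \<open>The absolute value supplies the alternating sign in \<open>G\<close>; the two
      factors -2 relating Genocchi to Bernoulli numbers give the 4 that remains of 8/2.\<close>
    have abs_u: "\<bar>u\<bar> = (-1) ^ (k + 1) * u"
      unfolding u_def using k by (intro abs_bernoulli_num_even) auto
    show "- (1 / 2) * (2 ^ (2 * r + 2) * (2 ^ (2 * k) - 1) * (2 ^ (2 * (r + 1 - k)) - 1)
               * \<bar>bernoulli_num (2 * k)\<bar> * bernoulli_num (2 * (r + 1 - k))
               / (fact (2 * k) * fact (2 * (r + 1 - k))) * \<alpha> ^ k * \<beta> ^ (r + 1 - k))
        = - (2 ^ (2 * r - 1)) * G k"
      unfolding G_def D_def P_def genocchi_num_eq_bernoulli_num r(1)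
      unfolding a_def[symmetric] b_def[symmetric] u_def[symmetric] v_def[symmetric]
        d_def[symmetric] e_def[symmetric] abs_u by simp
  qed auto
  have euler: "- (2 ^ (2 * r + 1)) * (\<Sum>k = 1..r.
             (- 1) ^ (k + 1) * (real k * real (r + 1 - k)
               * euler_poly (2 * k - 1) 0 * euler_poly (2 * (r + 1 - k) - 1) 0)
               / (fact (2 * k) * fact (2 * (r + 1 - k))) * \<alpha> ^ k * \<beta> ^ (r + 1 - k))
      = - (2 ^ (2 * r - 1)) * (\<Sum>k = 1..r. G k)"
    unfolding sum_distrib_left
  proof (rule sum.cong)
    fix k assume k: "k \<in> {1..r}"
    have G: "genocchi_num (2 * i) = 2 * real i * euler_poly (2 * i - 1) 0" if "i \<ge> 1" for i
    proof -
      have "Suc (2 * i - 1) = 2 * i" using that by simp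
      thus ?thesis
        using genocchi_num_eq_euler_poly[of "2 * i - 1"] by simp
    qed
    have "r + 1 - k \<ge> 1" "k \<ge> 1"
      using k by auto
    note G = G[OF this(1)] G[OF this(2)]
    define u v where "u = euler_poly (2 * k - 1) 0" and "v = euler_poly (2 * (r + 1 - k) - 1) 0"
    \<comment> \<open>The 4 splits into one factor 2 for each Genocchi number, since G_(2i) = 2 i
      E_(2i-1)(0).\<close>
    have *: "- (4 * p) * (s * (x * y * u * v) / d * a * b) = - p * (s * ((2 * x * u) * (2 * y * v)) / d * (a * b))"
      for p s x y d a b :: real
      by simp
    show "- (2 ^ (2 * r + 1)) * ((- 1) ^ (k + 1) * (real k * real (r + 1 - k)
               * euler_poly (2 * k - 1) 0 * euler_poly (2 * (r + 1 - k) - 1) 0)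
               / (fact (2 * k) * fact (2 * (r + 1 - k))) * \<alpha> ^ k * \<beta> ^ (r + 1 - k))
        = - (2 ^ (2 * r - 1)) * G k"
      unfolding G_def D_def P_def G r(2)
      unfolding u_def[symmetric] v_def[symmetric] by (rule *)
  qed auto
  have genocchi: "(\<Sum>k = 1..r. (- 1) ^ (k + 1) * (genocchi_num (2 * k) * genocchi_num (2 * (r + 1 - k)))
               / (fact (2 * k) * fact (2 * (r + 1 - k))) * \<alpha> ^ k * \<beta> ^ (r + 1 - k)) = (\<Sum>k = 1..r. G k)"
    by (simp only: G_def D_def P_def mult.assoc)
  have S: "1 / 2 * dirichlet_lambda (2 * real r + 1)
           - (\<Sum>m. real (2 * m + 1) powi (- 2 * int r - 1) / (exp (2 * real (2 * m + 1) * \<gamma>) + 1))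
         = 1 / 2 * S \<gamma>" if "\<gamma> > 0" for \<gamma>
    unfolding S_def using that assms(4) by (rule tanh_lambda_suminf)
  show ?thesis
    unfolding Let_def S[OF assms(1)] S[OF assms(2)] lhs bernoulli euler genocchi by simp
qed

end
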